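(* (1) Over strictly monotonic timed words (and hence also over weakly monotonic timed words), $\mathrm{BMTL}[U,S]\not\subseteq\mathrm{MTL}[F,P]$. (2) Over weakly monotonic timed words, $\mathrm{BMTL}[U,S]\not\subseteq\mathrm{TPTL}[F,P]$.
   Context: Fix a finite alphabet $\Sigma$. A (weakly monotonic) timed word is $\rho=(\sigma_1,\tau_1)\cdots(\sigma_n,\tau_n)$, $n\ge1$, $\sigma_i\in\Sigma$, $\tau_i\in\mathbb{R}_{\ge0}$, $\tau_1=0$, $\tau_i\le\tau_{i+1}$; it is strictly monotonic if $\tau_i<\tau_{i+1}$ for all $i$. An interval is a convex subset of $\mathbb{R}_{\ge0}$ with endpoints non-negative integers or $\infty$ (finite ends open or closed); bounded if it does not extend to $\infty$. MTL$[U,S]$: $\phi::=a\mid\phi\wedge\phi\mid\neg\phi\mid\phi U_I\phi\mid\phi S_I\phi$, with $\rho,i\models\phi_1U_I\phi_2$ iff $\exists j>i$: $\rho,j\models\phi_2$, $\tau_j-\tau_i\in I$, $\forall i<k<j$: $\rho,k\models\phi_1$, and symmetrically for $S_I$ (with $j<i$, $\tau_i-\tau_j\in I$); $\rho,i\models a$ iff $\sigma_i=a$. $F_I\phi:=\top U_I\phi$, $P_I\phi:=\top S_I\phi$. BMTL$[U,S]$ uses only bounded intervals; MTL$[F,P]$ uses only $F_I,P_I$ (any intervals). TPTL$[F,P]$: fix a finite set $\mathcal{X}$ of freeze variables; valuations $\nu:\mathcal{X}\to\mathbb{R}_{\ge0}$, $\nu_0\equiv0$; guards $g::=g\wedge g\mid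 x-T\approx c$ with $\approx\in\{<,\le,>,\ge,=\}$, $c\in\mathbb{Z}$, where $\nu,t\models x-T\approx c$ iff $\nu(x)-t\approx c$; formulas $\phi::=a\mid g\mid F\phi\mid P\phi\mid x.\phi\mid\phi\vee\phi\mid\neg\phi$ with $\rho,i,\nu\models g$ iff $\nu,\tau_i\models g$; $\rho,i,\nu\models F\phi$ iff $\exists j>i$: $\rho,j,\nu\models\phi$; $\rho,i,\nu\models P\phi$ iff $\exists j<i$: $\rho,j,\nu\models\phi$; $\rho,i,\nu\models x.\phi$ iff $\rho,i,\nu[x\mapsto\tau_i]\models\phi$. Languages: $\{\rho:\rho,1\models\phi\}$ for MTL, $\{\rho:\rho,1,\nu_0\models\phi\}$ for TPTL. "$\mathcal{G}_2\not\subseteq\mathcal{G}_1$ over a class $C$ of timed words" means there is a $\mathcal{G}_2$ formula $\phi$ such that no $\mathcal{G}_1$ formula $\psi$ is satisfied by exactly the same words of $C$ as $\phi$.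
   Formalization: Part (2) is stated for alphabets with at least two letters: over a one-letter alphabet, with at least one freeze variable, every BMTL[U,S] formula is expressible in TPTL[F,P], so the claim fails there. *)

theory Defs
  imports Complex_Main "HOL-Library.Cardinality"
begin

section \<open>Timed words\<close>

text \<open>The informal position \<open>i\<close> (counted from 1) is the list index \<open>i - 1\<close>.\<close>

type_synonym 'a timed_word = "('a \<times> real) list"

abbreviation letter_at :: "'a timed_word \<Rightarrow> nat \<Rightarrow> 'a" where
  "letter_at \<rho> i \<equiv> fst (\<rho> ! i)"

abbreviation time_at :: "'a timed_word \<Rightarrow> nat \<Rightarrow> real" where
  "time_at \<rho> i \<equiv> snd (\<rho> ! i)"

definition weak_timed_words :: "'a timed_word set" where
  "weak_timed_words = {\<rho>. \<rho> \<noteq> [] \<and> time_at \<rho> 0 = 0 \<and>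
     (\<forall>i. Suc i < length \<rho> \<longrightarrow> time_at \<rho> i \<le> time_at \<rho> (Suc i))}"

definition strict_timed_words :: "'a timed_word set" where
  "strict_timed_words = {\<rho> \<in> weak_timed_words.
     \<forall>i. Suc i < length \<rho> \<longrightarrow> time_at \<rho> i < time_at \<rho> (Suc i)}"

section \<open>Intervals\<close>

datatype endpoint = Closed nat | Open nat

text \<open>An upper end \<open>None\<close> stands for infinity. Pairs such as \<open>(Open 1, Some (Open 1))\<close> denote
  the empty interval.\<close>

datatype interval = Interval (lower: endpoint) (upper: "endpoint option")

fun above :: "endpoint \<Rightarrow> real \<Rightarrow> bool" where
  "above (Closed l) t \<longleftrightarrow> real l \<le> t"
| "above (Open l) t \<longleftrightarrow> real l < t"

fun below :: "endpoint option \<Rightarrow> real \<Rightarrow> bool" where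
  "below None t \<longleftrightarrow> True"
| "below (Some (Closed u)) t \<longleftrightarrow> t \<le> real u"
| "below (Some (Open u)) t \<longleftrightarrow> t < real u"

definition reals_of :: "interval \<Rightarrow> real set" where
  "reals_of I = {t. above (lower I) t \<and> below (upper I) t}"

definition bounded_interval :: "interval \<Rightarrow> bool" where
  "bounded_interval I \<longleftrightarrow> upper I \<noteq> None"

section \<open>Metric temporal logic\<close>

datatype 'a mtl =
    Atom 'a
  | And "'a mtl" "'a mtl"
  | Neg "'a mtl"
  | Until "'a mtl" interval "'a mtl"
  | Since "'a mtl" interval "'a mtl"

primrec mtl_sat :: "'a timed_word \<Rightarrow> nat \<Rightarrow> 'a mtl \<Rightarrow> bool" where
  "mtl_sat \<rho> i (Atom a) \<longleftrightarrow> letter_at \<rho> i = a"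
| "mtl_sat \<rho> i (And \<phi> \<psi>) \<longleftrightarrow> mtl_sat \<rho> i \<phi> \<and> mtl_sat \<rho> i \<psi>"
| "mtl_sat \<rho> i (Neg \<phi>) \<longleftrightarrow> \<not> mtl_sat \<rho> i \<phi>"
| "mtl_sat \<rho> i (Until \<phi> I \<psi>) \<longleftrightarrow>
     (\<exists>j. i < j \<and> j < length \<rho> \<and> mtl_sat \<rho> j \<psi> \<and> time_at \<rho> j - time_at \<rho> i \<in> reals_of I \<and>
        (\<forall>k. i < k \<and> k < j \<longrightarrow> mtl_sat \<rho> k \<phi>))"
| "mtl_sat \<rho> i (Since \<phi> I \<psi>) \<longleftrightarrow>
     (\<exists>j. j < i \<and> mtl_sat \<rho> j \<psi> \<and> time_at \<rho> i - time_at \<rho> j \<in> reals_of I \<and>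
        (\<forall>k. j < k \<and> k < i \<longrightarrow> mtl_sat \<rho> k \<phi>))"

text \<open>The grammar has no constant for truth; the letter chosen here is immaterial.\<close>

definition mtl_top :: "'a mtl" where
  "mtl_top = Neg (And (Atom undefined) (Neg (Atom undefined)))"

definition mtl_F :: "interval \<Rightarrow> 'a mtl \<Rightarrow> 'a mtl" where
  "mtl_F I \<phi> = Until mtl_top I \<phi>"

definition mtl_P :: "interval \<Rightarrow> 'a mtl \<Rightarrow> 'a mtl" where
  "mtl_P I \<phi> = Since mtl_top I \<phi>"

inductive_set BMTL_US :: "'a mtl set" where
  "Atom a \<in> BMTL_US"
| "\<phi> \<in> BMTL_US \<Longrightarrow> \<psi> \<in> BMTL_US \<Longrightarrow> And \<phi> \<psi> \<in> BMTL_US"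
| "\<phi> \<in> BMTL_US \<Longrightarrow> Neg \<phi> \<in> BMTL_US"
| "\<phi> \<in> BMTL_US \<Longrightarrow> \<psi> \<in> BMTL_US \<Longrightarrow> bounded_interval I \<Longrightarrow> Until \<phi> I \<psi> \<in> BMTL_US"
| "\<phi> \<in> BMTL_US \<Longrightarrow> \<psi> \<in> BMTL_US \<Longrightarrow> bounded_interval I \<Longrightarrow> Since \<phi> I \<psi> \<in> BMTL_US"

inductive_set MTL_FP :: "'a mtl set" where
  "Atom a \<in> MTL_FP"
| "\<phi> \<in> MTL_FP \<Longrightarrow> \<psi> \<in> MTL_FP \<Longrightarrow> And \<phi> \<psi> \<in> MTL_FP"
| "\<phi> \<in> MTL_FP \<Longrightarrow> Neg \<phi> \<in> MTL_FP"
| "\<phi> \<in> MTL_FP \<Longrightarrow> mtl_F I \<phi> \<in> MTL_FP"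
| "\<phi> \<in> MTL_FP \<Longrightarrow> mtl_P I \<phi> \<in> MTL_FP"

definition mtl_lang :: "'a mtl \<Rightarrow> 'a timed_word set" where
  "mtl_lang \<phi> = {\<rho> \<in> weak_timed_words. mtl_sat \<rho> 0 \<phi>}"

section \<open>Timed propositional temporal logic with unary modalities\<close>

datatype comparison = Less | LessEq | Greater | GreaterEq | Equal

primrec compare :: "comparison \<Rightarrow> real \<Rightarrow> real \<Rightarrow> bool" where
  "compare Less s t \<longleftrightarrow> s < t"
| "compare LessEq s t \<longleftrightarrow> s \<le> t"
| "compare Greater s t \<longleftrightarrow> s > t"
| "compare GreaterEq s t \<longleftrightarrow> s \<ge> t"
| "compare Equal s t \<longleftrightarrow> s = t"

text \<open>\<open>Diff x r c\<close> is the constraint \<open>x - T r c\<close>.\<close>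

datatype 'x guard = GAnd "'x guard" "'x guard" | Diff 'x comparison int

primrec guard_sat :: "('x \<Rightarrow> real) \<Rightarrow> real \<Rightarrow> 'x guard \<Rightarrow> bool" where
  "guard_sat \<nu> t (GAnd g h) \<longleftrightarrow> guard_sat \<nu> t g \<and> guard_sat \<nu> t h"
| "guard_sat \<nu> t (Diff x r c) \<longleftrightarrow> compare r (\<nu> x - t) (real_of_int c)"

datatype (tptl_letters: 'a, tptl_vars: 'x) tptl =
    TAtom 'a
  | TGuard "'x guard"
  | TF "('a, 'x) tptl"
  | TP "('a, 'x) tptl"
  | Freeze 'x "('a, 'x) tptl"
  | TOr "('a, 'x) tptl" "('a, 'x) tptl"
  | TNeg "('a, 'x) tptl"

primrec tptl_sat :: "'a timed_word \<Rightarrow> nat \<Rightarrow> ('x \<Rightarrow> real) \<Rightarrow> ('a, 'x) tptl \<Rightarrow> bool" where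
  "tptl_sat \<rho> i \<nu> (TAtom a) \<longleftrightarrow> letter_at \<rho> i = a"
| "tptl_sat \<rho> i \<nu> (TGuard g) \<longleftrightarrow> guard_sat \<nu> (time_at \<rho> i) g"
| "tptl_sat \<rho> i \<nu> (TF \<phi>) \<longleftrightarrow> (\<exists>j. i < j \<and> j < length \<rho> \<and> tptl_sat \<rho> j \<nu> \<phi>)"
| "tptl_sat \<rho> i \<nu> (TP \<phi>) \<longleftrightarrow> (\<exists>j. j < i \<and> tptl_sat \<rho> j \<nu> \<phi>)"
| "tptl_sat \<rho> i \<nu> (Freeze x \<phi>) \<longleftrightarrow> tptl_sat \<rho> i (\<nu>(x := time_at \<rho> i)) \<phi>"
| "tptl_sat \<rho> i \<nu> (TOr \<phi> \<psi>) \<longleftrightarrow> tptl_sat \<rho> i \<nu> \<phi> \<or> tptl_sat \<rho> i \<nu> \<psi>"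
| "tptl_sat \<rho> i \<nu> (TNeg \<phi>) \<longleftrightarrow> \<not> tptl_sat \<rho> i \<nu> \<phi>"

text \<open>The set \<open>tptl_vars \<phi>\<close> contains all variables occurring in \<open>\<phi>\<close>, in guards or frozen.\<close>

definition TPTL_FP :: "'x set \<Rightarrow> ('a, 'x) tptl set" where
  "TPTL_FP X = {\<phi>. tptl_vars \<phi> \<subseteq> X}"

definition tptl_lang :: "('a, 'x) tptl \<Rightarrow> 'a timed_word set" where
  "tptl_lang \<phi> = {\<rho> \<in> weak_timed_words. tptl_sat \<rho> 0 (\<lambda>_. 0) \<phi>}"

section \<open>Comparing expressive power\<close>

text \<open>A logic is given by its set of formulas together with its language function.\<close>

definition not_subsumed_over ::
  "'w set \<Rightarrow> 'f set \<Rightarrow> ('f \<Rightarrow> 'w set) \<Rightarrow> 'g set \<Rightarrow> ('g \<Rightarrow> 'w set) \<Rightarrow> bool" where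
  "not_subsumed_over C G\<^sub>2 lang\<^sub>2 G\<^sub>1 lang\<^sub>1 \<longleftrightarrow>
     (\<exists>\<phi>\<in>G\<^sub>2. \<not> (\<exists>\<psi>\<in>G\<^sub>1. lang\<^sub>1 \<psi> \<inter> C = lang\<^sub>2 \<phi> \<inter> C))"

end

theory Submission imports Defs begin

text \<open>The separating formulas say that two consecutive positions satisfy a property \<open>p\<close>. Unary
  temporal modalities of nesting depth \<open>k\<close> cannot tell \<open>(ab)\<^sup>2\<^sup>n\<close> from \<open>(ab)\<^sup>n a (ab)\<^sup>n\<close> for large
  \<open>n\<close>, although only the second word has the factor \<open>aa\<close>.

  For TPTL, put all letters at time 0, where guards and freezing carry no information. For MTL, a
  single letter suffices: a word of length \<open>L\<close> becomes the set of times \<open>s / L\<close>, together with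
  \<open>1 + s / L\<close> for those \<open>s\<close> that carry an \<open>a\<close>, and \<open>p\<close> says that there is an event exactly one time
  unit later. Membership of a time difference in an interval with integer endpoints depends only
  on the difference of the integral parts and on the order of the fractional parts, so the play on
  untimed words lifts to the timed ones.\<close>

section \<open>The game for unary temporal modalities\<close>

text \<open>An Ehrenfeucht-Fraisse game with a single pebble pair: each round replaces the pair,
  respecting only the order relative to the previous one. This fits unary modalities, which forget
  the old position once they have moved.\<close>

primrec game_equiv :: "nat \<Rightarrow> 'b list \<Rightarrow> 'b list \<Rightarrow> nat \<Rightarrow> nat \<Rightarrow> bool" where
  "game_equiv 0 u v i j \<longleftrightarrow> i < length u \<and> j < length v \<and> u ! i = v ! j"
| "game_equiv (Suc k) u v i j \<longleftrightarrow> i < length u \<and> j < length v \<and> u ! i = v ! j \<and>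
     (\<forall>i'<length u. \<exists>j'<length v. (i < i' \<longleftrightarrow> j < j') \<and> (i' < i \<longleftrightarrow> j' < j) \<and> game_equiv k u v i' j') \<and>
     (\<forall>j'<length v. \<exists>i'<length u. (i < i' \<longleftrightarrow> j < j') \<and> (i' < i \<longleftrightarrow> j' < j) \<and> game_equiv k u v i' j')"

lemma game_equiv_sym: "game_equiv k u v i j \<Longrightarrow> game_equiv k v u j i"
proof (induction k arbitrary: i j)
  case (Suc k)
  then show ?case by (simp, metis)
qed auto

lemma game_equivD:
  assumes "game_equiv k u v i j"
  shows "i < length u" "j < length v" "u ! i = v ! j"
  using assms by (cases k; simp)+

lemma game_equiv_Suc_imp: "game_equiv (Suc k) u v i j \<Longrightarrow> game_equiv k u v i j"
proof (induction k arbitrary: i j)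
  case (Suc k)
  then show ?case by (subst game_equiv.simps, subst (asm) (3) game_equiv.simps) meson
qed simp

lemma game_equiv_antimono:
  assumes "game_equiv m u v i j" "k \<le> m"
  shows "game_equiv k u v i j"
  using assms(2,1) by (induction rule: inc_induct) (blast dest: game_equiv_Suc_imp)+

section \<open>The two untimed words and the duplicator's strategy\<close>

definition plain_word :: "nat \<Rightarrow> bool list" where
  "plain_word n = map even [0..<4 * n]"

text \<open>The parity convention flips after position \<open>2 * n\<close>, so for positive
  \<open>n\<close> the neighbours \<open>2 * n\<close> and \<open>2 * n + 1\<close> both carry
  True.\<close>

definition stutter_word :: "nat \<Rightarrow> bool list" where
  "stutter_word n = map (\<lambda>i. even i = (i \<le> 2 * n)) [0..<4 * n + 1]"

text \<open>Since the second word is one letter longer, \<open>j = i + 1\<close> says that the distances to the right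
  ends agree.\<close>

definition close_pos :: "nat \<Rightarrow> nat \<Rightarrow> nat \<Rightarrow> nat \<Rightarrow> bool" where
  "close_pos n k i j \<longleftrightarrow> i < 4 * n \<and> j < 4 * n + 1 \<and> (even i \<longleftrightarrow> (even j \<longleftrightarrow> j \<le> 2 * n)) \<and>
     (i = j \<or> 2 * k \<le> i \<and> 2 * k \<le> j) \<and> (j = i + 1 \<or> i + 2 * k < 4 * n \<and> j + 2 * k < 4 * n + 1)"

text \<open>Near an end, the reply keeps the exact distance to that end. Elsewhere, the margin
  shrinks by two per round, which frees two neighbouring positions between the old and the new
  margin; they carry different letters and lie on the required side of \<open>j\<close>.\<close>

lemma close_pos_forth:
  assumes "close_pos n (Suc k) i j" "Suc k \<le> n" "i' < 4 * n"
  shows "\<exists>j'<4 * n + 1. (i < i' \<longleftrightarrow> j < j') \<and> (i' < i \<longleftrightarrow> j' < j) \<and> close_pos n k i' j'"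
proof -
  obtain d where n: "n = Suc k + d"
    using assms(2) le_Suc_ex by blast
  have ij: "i = j \<or> 2 * k + 2 \<le> i \<and> 2 * k + 2 \<le> j"
    "j = i + 1 \<or> i + 2 * k + 2 < 4 * n \<and> j + 2 * k + 2 < 4 * n + 1"
    using assms(1) by (auto simp: close_pos_def)
  consider "i' = i" | "i' \<noteq> i" "i' + 2 * k + 2 \<ge> 4 * n" | "i' \<noteq> i" "i' < 2 * k + 2"
    | "i < i'" "i' + 2 * k + 2 < 4 * n" "2 * k + 2 \<le> i'"
    | "i' < i" "i' + 2 * k + 2 < 4 * n" "2 * k + 2 \<le> i'" by linarith
  then obtain j' where "j' < 4 * n + 1" "i < i' \<longleftrightarrow> j < j'" "i' < i \<longleftrightarrow> j' < j"
    "even i' \<longleftrightarrow> (even j' \<longleftrightarrow> j' \<le> 2 * n)" "i' = j' \<or> 2 * k \<le> i' \<and> 2 * k \<le> j'"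
    "j' = i' + 1 \<or> i' + 2 * k < 4 * n \<and> j' + 2 * k < 4 * n + 1"
  proof cases
    case 1
    then show ?thesis using assms(1) by (intro that[of j]) (auto simp: close_pos_def)
  next
    case 2
    then have "\<not> i' + 1 \<le> 2 * n" using n by linarith
    then show ?thesis using 2 ij assms(3) n by (intro that[of "i' + 1"]; auto)
  next
    case 3
    then have "i' \<le> 2 * n" using n by linarith
    then show ?thesis using 3 ij n by (intro that[of i']; auto)
  next
    \<comment> \<open>As \<open>4 * n = 4 * k + 4 * d + 4\<close>, the two candidates are the last
      positions of the longer word that the right margin \<open>2 * k\<close> admits. Both lie
      beyond \<open>2 * n\<close>, where odd positions carry True.\<close>
    case 4
    show ?thesis
    proof (cases "even i'")
      case True
      then show ?thesis using 4 ij n by (intro that[of "2 * k + 4 * d + 3"]; auto)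
    next
      case False
      then show ?thesis using 4 ij n by (intro that[of "2 * k + 4 * d + 4"]; auto)
    qed
  next
    \<comment> \<open>The candidates are the first two positions that the left margin
      \<open>2 * k\<close> admits; both lie before the parity flip.\<close>
    case 5
    show ?thesis
    proof (cases "even i'")
      case True
      then show ?thesis using 5 ij n by (intro that[of "2 * k"]; auto)
    next
      case False
      then show ?thesis using 5 ij n by (intro that[of "2 * k + 1"]; auto)
    qed
  qed
  then show ?thesis using assms(3) unfolding close_pos_def by blast
qed

text \<open>The roles of the two words are not symmetric, so this direction is separate. The idea is
  the same, but in the shorter word the last two admissible positions are one lower.\<close>

lemma close_pos_back:
  assumes "close_pos n (Suc k) i j" "Suc k \<le> n" "j' < 4 * n + 1"
  shows "\<exists>i'<4 * n. (i < i' \<longleftrightarrow> j < j') \<and> (i' < i \<longleftrightarrow> j' < j) \<and> close_pos n k i' j'"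
proof -
  obtain d where n: "n = Suc k + d"
    using assms(2) le_Suc_ex by blast
  have ij: "i = j \<or> 2 * k + 2 \<le> i \<and> 2 * k + 2 \<le> j"
    "j = i + 1 \<or> i + 2 * k + 2 < 4 * n \<and> j + 2 * k + 2 < 4 * n + 1"
    using assms(1) by (auto simp: close_pos_def)
  consider "j' = j" | "j' \<noteq> j" "j' + 2 * k + 2 \<ge> 4 * n + 1" | "j' \<noteq> j" "j' < 2 * k + 2"
    | "j < j'" "j' + 2 * k + 2 < 4 * n + 1" "2 * k + 2 \<le> j'"
    | "j' < j" "j' + 2 * k + 2 < 4 * n + 1" "2 * k + 2 \<le> j'" by linarith
  then obtain i' where "i' < 4 * n" "i < i' \<longleftrightarrow> j < j'" "i' < i \<longleftrightarrow> j' < j"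
    "even i' \<longleftrightarrow> (even j' \<longleftrightarrow> j' \<le> 2 * n)" "i' = j' \<or> 2 * k \<le> i' \<and> 2 * k \<le> j'"
    "j' = i' + 1 \<or> i' + 2 * k < 4 * n \<and> j' + 2 * k < 4 * n + 1"
  proof cases
    case 1
    then show ?thesis using assms(1) by (intro that[of i]) (auto simp: close_pos_def)
  next
    case 2
    \<comment> \<open>Equal distance to the right ends means replying with the predecessor of
      \<open>j'\<close>, which is positive here.\<close>
    then obtain i' where i': "j' = i' + 1" using n by (cases j') auto
    then have "\<not> i' + 1 \<le> 2 * n" using 2 n by linarith
    then show ?thesis using 2 i' ij assms(3) n by (intro that[of i']; auto)
  next
    case 3
    then have "j' \<le> 2 * n" using n by linarith
    then show ?thesis using 3 ij n by (intro that[of j']; auto)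
  next
    case 4
    show ?thesis
    proof (cases "even j' \<longleftrightarrow> j' \<le> 2 * n")
      case True
      then show ?thesis using 4 ij n by (intro that[of "2 * k + 4 * d + 2"]; auto)
    next
      case False
      then show ?thesis using 4 ij n by (intro that[of "2 * k + 4 * d + 3"]; auto)
    qed
  next
    case 5
    show ?thesis
    proof (cases "even j' \<longleftrightarrow> j' \<le> 2 * n")
      case True
      then show ?thesis using 5 ij n by (intro that[of "2 * k"]; auto)
    next
      case False
      then show ?thesis using 5 ij n by (intro that[of "2 * k + 1"]; auto)
    qed
  qed
  then show ?thesis using assms(3) unfolding close_pos_def by blast
qed

lemma close_pos_imp_game_equiv:
  "close_pos n k i j \<Longrightarrow> k \<le> n \<Longrightarrow> game_equiv k (plain_word n) (stutter_word n) i j"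
proof (induction k arbitrary: i j)
  case 0
  then show ?case
    by (simp add: close_pos_def plain_word_def stutter_word_def del: upt_Suc)
next
  case (Suc k)
  have len: "length (plain_word n) = 4 * n" "length (stutter_word n) = 4 * n + 1"
    by (simp_all add: plain_word_def stutter_word_def)
  have "plain_word n ! i = stutter_word n ! j" "i < 4 * n" "j < 4 * n + 1"
    using Suc.prems by (simp_all add: close_pos_def plain_word_def stutter_word_def del: upt_Suc)
  then show ?case
    unfolding game_equiv.simps len
    using close_pos_forth[OF Suc.prems] close_pos_back[OF Suc.prems] Suc.IH Suc.prems(2)
    by (meson Suc_leD)
qed

text \<open>Both starts are left ends and far from the right ends. The successor keeps
  \<open>plain_word\<close> nonempty even for \<open>k = 0\<close>.\<close>

lemma game_equiv_plain_stutter: "game_equiv k (plain_word (Suc k)) (stutter_word (Suc k)) 0 0"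
  by (rule close_pos_imp_game_equiv) (auto simp: close_pos_def)

section \<open>The separating formulas\<close>

definition unit_interval :: interval where
  "unit_interval = Interval (Closed 0) (Some (Open 1))"

text \<open>The inner until, with false on its left, is a next modality. The interval
  \<open>[0,1)\<close> is bounded, yet admits every forward time difference in words with constant
  time and within the first row of the grid words below.\<close>

definition adjacent_pair :: "'a mtl \<Rightarrow> 'a mtl" where
  "adjacent_pair p =
     Until mtl_top unit_interval (And p (Until (Neg mtl_top) unit_interval p))"

lemma mtl_sat_top [simp]: "mtl_sat \<rho> i mtl_top"
  by (simp add: mtl_top_def)

lemma mtl_top_BMTL_US: "mtl_top \<in> BMTL_US"
  unfolding mtl_top_def by (intro BMTL_US.intros)

lemma adjacent_pair_BMTL_US: "p \<in> BMTL_US \<Longrightarrow> adjacent_pair p \<in> BMTL_US"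
  unfolding adjacent_pair_def
  by (intro BMTL_US.intros mtl_top_BMTL_US) (simp_all add: bounded_interval_def unit_interval_def)

lemma in_unit_interval: "t \<in> reals_of unit_interval \<longleftrightarrow> 0 \<le> t \<and> t < 1"
  by (simp add: reals_of_def unit_interval_def)

lemma mtl_sat_next:
  "mtl_sat \<rho> i (Until (Neg mtl_top) I p) \<longleftrightarrow>
     Suc i < length \<rho> \<and> mtl_sat \<rho> (Suc i) p \<and> time_at \<rho> (Suc i) - time_at \<rho> i \<in> reals_of I"
proof -
  have "j = Suc i" if "i < j" "\<forall>k. i < k \<and> k < j \<longrightarrow> mtl_sat \<rho> k (Neg mtl_top)" for j
    using that by (metis Suc_lessI lessI mtl_sat.simps(3) mtl_sat_top)
  then show ?thesis
    unfolding mtl_sat.simps(4) by (metis Suc_lessD lessI not_less_eq)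
qed

lemma mtl_sat_adjacent_pair:
  "mtl_sat \<rho> 0 (adjacent_pair p) \<longleftrightarrow>
     (\<exists>j>0. Suc j < length \<rho> \<and> mtl_sat \<rho> j p \<and> mtl_sat \<rho> (Suc j) p \<and>
        time_at \<rho> j - time_at \<rho> 0 \<in> {0..<1} \<and> time_at \<rho> (Suc j) - time_at \<rho> j \<in> {0..<1})"
  \<comment> \<open>Only the outer until, whose left argument is \<open>mtl_top\<close>, is
    unfolded; the inner one is left to \<open>mtl_sat_next\<close>.\<close>
  unfolding adjacent_pair_def mtl_sat.simps(4)[of _ _ mtl_top] mtl_sat.simps(2) mtl_sat_next
    in_unit_interval
  by auto

lemma plain_word_no_adjacent:
  "Suc j < length (plain_word n) \<Longrightarrow> \<not> (plain_word n ! j \<and> plain_word n ! Suc j)"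
  by (simp add: plain_word_def)

lemma stutter_word_adjacent:
  assumes "0 < n"
  shows "Suc (2 * n) < length (stutter_word n)" "stutter_word n ! (2 * n)"
    "stutter_word n ! Suc (2 * n)"
  using assms by (simp_all add: stutter_word_def del: upt_Suc)

section \<open>TPTL over words with constant time\<close>

definition untimed :: "'a \<Rightarrow> 'a \<Rightarrow> bool list \<Rightarrow> 'a timed_word" where
  "untimed a b u = map (\<lambda>x. (if x then a else b, 0)) u"

lemma untimed_simps [simp]:
  "length (untimed a b u) = length u"
  "i < length u \<Longrightarrow> untimed a b u ! i = (if u ! i then a else b, 0)"
  by (simp_all add: untimed_def)

lemma untimed_weak: "u \<noteq> [] \<Longrightarrow> untimed a b u \<in> weak_timed_words"
  by (auto simp: weak_timed_words_def simp flip: length_greater_0_conv)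

text \<open>Freezing overwrites 0 by 0, so the valuation never changes and a guard has the same
  truth value everywhere. What remains is a unary temporal formula; each \<open>TF\<close> or
  \<open>TP\<close> costs one more round.\<close>

lemma tptl_untimed_indistinguishable:
  fixes \<phi> :: "('a, 'x) tptl"
  shows "\<exists>k. \<forall>u v i j. game_equiv k u v i j \<longrightarrow>
    tptl_sat (untimed a b u) i (\<lambda>_. 0) \<phi> = tptl_sat (untimed a b v) j (\<lambda>_. 0) \<phi>"
proof (induction \<phi>)
  case (TAtom c)
  then show ?case by (intro exI[of _ 0]) auto
next
  case (TGuard g)
  then show ?case by (intro exI[of _ 0]) auto
next
  case (TF \<phi>)
  then obtain k where k: "\<And>u v i j. game_equiv k u v i j \<Longrightarrow>
    tptl_sat (untimed a b u) i (\<lambda>_. 0) \<phi> = tptl_sat (untimed a b v) j (\<lambda>_. 0) \<phi>" by blast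
  show ?case
    by (rule exI[of _ "Suc k"]) (simp, metis k)
next
  case (TP \<phi>)
  then obtain k where k: "\<And>u v i j. game_equiv k u v i j \<Longrightarrow>
    tptl_sat (untimed a b u) i (\<lambda>_. 0) \<phi> = tptl_sat (untimed a b v) j (\<lambda>_. 0) \<phi>" by blast
  have "tptl_sat (untimed a b v) j (\<lambda>_. 0) (TP \<phi>)"
    if eq: "game_equiv (Suc k) u v i j" and sat: "tptl_sat (untimed a b u) i (\<lambda>_. 0) (TP \<phi>)"
    for u v i j
  proof -
    obtain i' where i': "i' < i" "tptl_sat (untimed a b u) i' (\<lambda>_. 0) \<phi>"
      using sat by auto
    \<comment> \<open>The semantics of \<open>TP\<close> states no length bound for its witness, but
      a move of the game needs one.\<close>
    then have "i' < length u"
      using game_equivD(1)[OF eq] by simp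
    then obtain j' where "j' < j" "game_equiv k u v i' j'"
      using eq i'(1) by (simp, blast)
    then show ?thesis using k i'(2) by auto
  qed
  then show ?case by (blast intro: game_equiv_sym)
next
  case (Freeze x \<phi>)
  then obtain k where k: "\<And>u v i j. game_equiv k u v i j \<Longrightarrow>
    tptl_sat (untimed a b u) i (\<lambda>_. 0) \<phi> = tptl_sat (untimed a b v) j (\<lambda>_. 0) \<phi>" by blast
  have "tptl_sat (untimed a b w) i (\<lambda>_. 0) (Freeze x \<phi>) = tptl_sat (untimed a b w) i (\<lambda>_. 0) \<phi>"
    if "i < length w" for w i
    using that by (simp add: fun_upd_idem)
  then show ?case using k game_equivD(1,2) by metis
next
  case (TOr \<phi> \<psi>)
  obtain k where k: "\<And>u v i j. game_equiv k u v i j \<Longrightarrow>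
      tptl_sat (untimed a b u) i (\<lambda>_. 0) \<phi> = tptl_sat (untimed a b v) j (\<lambda>_. 0) \<phi>"
    using TOr.IH(1) by blast
  obtain l where l: "\<And>u v i j. game_equiv l u v i j \<Longrightarrow>
      tptl_sat (untimed a b u) i (\<lambda>_. 0) \<psi> = tptl_sat (untimed a b v) j (\<lambda>_. 0) \<psi>"
    using TOr.IH(2) by blast
  show ?case
    by (rule exI[of _ "max k l"])
      (metis k l game_equiv_antimono max.cobounded1 max.cobounded2 tptl_sat.simps(6))
qed simp

lemma BMTL_US_not_subsumed_TPTL_FP:
  assumes "(a::'a) \<noteq> b"
  shows "not_subsumed_over (weak_timed_words :: 'a timed_word set)
           BMTL_US mtl_lang (TPTL_FP X) tptl_lang"
proof -
  let ?\<phi> = "adjacent_pair (Atom a)"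
  have "tptl_lang \<psi> \<inter> weak_timed_words \<noteq> mtl_lang ?\<phi> \<inter> weak_timed_words"
    for \<psi> :: "('a, 'x) tptl"
  proof
    assume eq: "tptl_lang \<psi> \<inter> weak_timed_words = mtl_lang ?\<phi> \<inter> weak_timed_words"
    obtain k where k: "\<And>u v i j. game_equiv k u v i j \<Longrightarrow>
        tptl_sat (untimed a b u) i (\<lambda>_. 0) \<psi> = tptl_sat (untimed a b v) j (\<lambda>_. 0) \<psi>"
      using tptl_untimed_indistinguishable[of a b \<psi>] by blast
    let ?u = "plain_word (Suc k)" and ?v = "stutter_word (Suc k)"
    have ne: "?u \<noteq> []" "?v \<noteq> []"
      by (simp_all add: plain_word_def stutter_word_def)
    have sat_iff: "tptl_sat (untimed a b w) 0 (\<lambda>_. 0) \<psi> = mtl_sat (untimed a b w) 0 ?\<phi>"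
      if "w \<noteq> []" for w
      using eq untimed_weak[OF that, of a b] by (auto simp: tptl_lang_def mtl_lang_def)
    have "mtl_sat (untimed a b ?u) 0 ?\<phi> = mtl_sat (untimed a b ?v) 0 ?\<phi>"
      using sat_iff ne k game_equiv_plain_stutter by blast
    \<comment> \<open>As \<open>a\<close> differs from \<open>b\<close>, it stands only where the
      Boolean word has True, and True never occurs twice in a row.\<close>
    moreover have "\<not> mtl_sat (untimed a b ?u) 0 ?\<phi>"
      unfolding mtl_sat_adjacent_pair
      using plain_word_no_adjacent assms by (auto split: if_splits)
    moreover have "mtl_sat (untimed a b ?v) 0 ?\<phi>"
      unfolding mtl_sat_adjacent_pair
      using stutter_word_adjacent[of "Suc k"] ne by (intro exI[of _ "2 * Suc k"]) auto
    ultimately show False by blast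
  qed
  then show ?thesis
    unfolding not_subsumed_over_def by (blast intro: adjacent_pair_BMTL_US BMTL_US.intros)
qed

section \<open>MTL over strictly monotonic words\<close>

text \<open>For \<open>s < length u\<close>, the row \<open>r\<close> is the integral part and the
  column \<open>s\<close> determines the fractional part.\<close>

definition grid_time :: "'b list \<Rightarrow> nat \<Rightarrow> nat \<Rightarrow> real" where
  "grid_time u r s = real r + real s / real (length u)"

definition grid_word :: "'a \<Rightarrow> bool list \<Rightarrow> 'a timed_word" where
  "grid_word c u = map (\<lambda>s. (c, grid_time u 0 s)) [0..<length u] @
     map (\<lambda>s. (c, grid_time u 1 s)) (filter ((!) u) [0..<length u])"

text \<open>Fractional parts differ by less than one, so floor and ceiling see only the order of the
  columns.\<close>

lemma grid_time_diff:
  assumes "s < length u" "s' < length u"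
  shows "\<lfloor>grid_time u r' s' - grid_time u r s\<rfloor> = int r' - int r - (if s' < s then 1 else 0)"
    and "\<lceil>grid_time u r' s' - grid_time u r s\<rceil> = int r' - int r + (if s < s' then 1 else 0)"
proof -
  define x y where "x = real s / length u" and "y = real s' / length u"
  have xy: "0 \<le> x" "x < 1" "0 \<le> y" "y < 1" "s < s' \<longleftrightarrow> x < y" "s' < s \<longleftrightarrow> y < x"
    using assms by (auto simp: x_def y_def divide_less_cancel divide_less_eq)
  have diff: "grid_time u r' s' - grid_time u r s = real r' - real r + (y - x)"
    by (simp add: grid_time_def x_def y_def)
  show "\<lfloor>grid_time u r' s' - grid_time u r s\<rfloor> = int r' - int r - (if s' < s then 1 else 0)"
    unfolding diff using xy by (intro floor_unique) auto
  show "\<lceil>grid_time u r' s' - grid_time u r s\<rceil> = int r' - int r + (if s < s' then 1 else 0)"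
    unfolding diff using xy by (intro ceiling_unique) auto
qed

lemma grid_time_diff_unit:
  assumes "s \<le> s'" "s' < length u"
  shows "grid_time u r s' - grid_time u r s \<in> {0..<1}"
  using grid_time_diff(1)[of s u s' r r] assms by (simp add: floor_eq_iff)

text \<open>Endpoints are integers: the floor decides closed lower and open upper ends, the ceiling
  decides the other two kinds.\<close>

lemma reals_of_cong:
  assumes "\<lfloor>x\<rfloor> = \<lfloor>y\<rfloor>" "\<lceil>x\<rceil> = \<lceil>y\<rceil>"
  shows "x \<in> reals_of I \<longleftrightarrow> y \<in> reals_of I"
proof -
  have le: "real m \<le> z \<longleftrightarrow> int m \<le> \<lfloor>z\<rfloor>" "z < real m \<longleftrightarrow> \<lfloor>z\<rfloor> < int m"
    "real m < z \<longleftrightarrow> int m < \<lceil>z\<rceil>" "z \<le> real m \<longleftrightarrow> \<lceil>z\<rceil> \<le> int m" for m z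
    by linarith+
  have "above e x = above e y" for e
    using assms by (cases e) (simp_all add: le)
  moreover have "below e x = below e y" for e
    using assms by (cases "(e, x)" rule: below.cases) (simp_all add: le)
  ultimately show ?thesis by (simp add: reals_of_def)
qed

lemma grid_time_less_iff:
  assumes "s < length u" "s' < length u"
  shows "grid_time u r s < grid_time u r' s' \<longleftrightarrow> r < r' \<or> r = r' \<and> s < s'"
proof -
  have "grid_time u r s < grid_time u r' s' \<longleftrightarrow> 0 < \<lceil>grid_time u r' s' - grid_time u r s\<rceil>"
    by linarith
  then show ?thesis using grid_time_diff[OF assms] by auto
qed

lemma sorted_grid_word: "sorted_wrt (\<lambda>x y. snd x < snd y) (grid_word c u)"
  unfolding grid_word_def sorted_wrt_append sorted_wrt_map
  by (auto simp: grid_time_less_iff intro!: sorted_wrt_filter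
      intro: sorted_wrt_mono_rel[OF _ sorted_wrt_upt])

lemma time_grid_word_less_iff:
  assumes "i < length (grid_word c u)" "j < length (grid_word c u)"
  shows "time_at (grid_word c u) i < time_at (grid_word c u) j \<longleftrightarrow> i < j"
  using sorted_wrt_nth_less[OF sorted_grid_word[of c u]] assms
  by (metis linorder_neqE_nat order_less_asym)

lemma grid_word_nth: "s < length u \<Longrightarrow> grid_word c u ! s = (c, grid_time u 0 s)"
  by (simp add: grid_word_def nth_append)

lemma length_grid_word: "length u \<le> length (grid_word c u)"
  by (simp add: grid_word_def)

lemma letter_grid_word: "i < length (grid_word c u) \<Longrightarrow> letter_at (grid_word c u) i = c"
  using nth_mem[of i "grid_word c u"] by (auto simp: grid_word_def)

lemma grid_word_strict: "u \<noteq> [] \<Longrightarrow> grid_word c u \<in> strict_timed_words"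
  using time_grid_word_less_iff[of _ c u] grid_word_nth[of 0 u c] length_grid_word[of u c]
  by (auto simp: strict_timed_words_def weak_timed_words_def grid_time_def intro: less_imp_le)

text \<open>Describing events by their times avoids computing indices in the filtered second
  row.\<close>

lemma times_grid_word:
  "(\<exists>i<length (grid_word c u). time_at (grid_word c u) i = t) \<longleftrightarrow>
     (\<exists>r s. s < length u \<and> (r = 0 \<or> r = 1 \<and> u ! s) \<and> t = grid_time u r s)"
proof -
  have "(\<exists>i<length (grid_word c u). time_at (grid_word c u) i = t) \<longleftrightarrow> t \<in> snd ` set (grid_word c u)"
    by (force simp: in_set_conv_nth)
  also have "\<dots> \<longleftrightarrow> (\<exists>r s. s < length u \<and> (r = 0 \<or> r = 1 \<and> u ! s) \<and> t = grid_time u r s)"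
    by (force simp: grid_word_def)
  finally show ?thesis .
qed

section \<open>Lifting the game to timed words\<close>

definition grid_equiv :: "'a \<Rightarrow> nat \<Rightarrow> bool list \<Rightarrow> bool list \<Rightarrow> nat \<Rightarrow> nat \<Rightarrow> bool" where
  "grid_equiv c k u v i j \<longleftrightarrow> i < length (grid_word c u) \<and> j < length (grid_word c v) \<and>
     (\<exists>r s t. game_equiv k u v s t \<and> time_at (grid_word c u) i = grid_time u r s \<and>
        time_at (grid_word c v) j = grid_time v r t)"

lemma grid_equiv_sym: "grid_equiv c k u v i j \<Longrightarrow> grid_equiv c k v u j i"
  unfolding grid_equiv_def by (blast intro: game_equiv_sym)

lemma grid_equiv_antimono: "grid_equiv c m u v i j \<Longrightarrow> k \<le> m \<Longrightarrow> grid_equiv c k u v i j"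
  unfolding grid_equiv_def by (blast intro: game_equiv_antimono)

text \<open>The reply copies the row and takes its column from the game. Equal row differences and
  equal column orders fix floor and ceiling of the time difference, hence its membership in any
  interval; both signs are recorded, for future and past.\<close>

lemma grid_equiv_forth:
  assumes "grid_equiv c (Suc k) u v i j" "i' < length (grid_word c u)"
  obtains j' where "grid_equiv c k u v i' j'" "j' < length (grid_word c v)"
    "i < i' \<longleftrightarrow> j < j'" "i' < i \<longleftrightarrow> j' < j"
    "\<And>I. time_at (grid_word c u) i' - time_at (grid_word c u) i \<in> reals_of I \<longleftrightarrow>
          time_at (grid_word c v) j' - time_at (grid_word c v) j \<in> reals_of I"
    "\<And>I. time_at (grid_word c u) i - time_at (grid_word c u) i' \<in> reals_of I \<longleftrightarrow>
          time_at (grid_word c v) j - time_at (grid_word c v) j' \<in> reals_of I"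
proof -
  let ?tu = "time_at (grid_word c u)" and ?tv = "time_at (grid_word c v)"
  obtain r s t where st: "game_equiv (Suc k) u v s t"
    and tu: "?tu i = grid_time u r s" and tv: "?tv j = grid_time v r t"
    and len: "i < length (grid_word c u)" "j < length (grid_word c v)"
    using assms(1) unfolding grid_equiv_def by blast
  obtain r' s' where s': "s' < length u" "r' = 0 \<or> r' = 1 \<and> u ! s'" and tu': "?tu i' = grid_time u r' s'"
    using assms(2) times_grid_word[of c u "?tu i'"] by blast
  obtain t' where t': "t' < length v" "s < s' \<longleftrightarrow> t < t'" "s' < s \<longleftrightarrow> t' < t"
      "game_equiv k u v s' t'"
    using st s'(1) by auto
  \<comment> \<open>If \<open>r' = 1\<close>, the event exists in the other word because the game
    preserves the letter of the column.\<close>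
  obtain j' where j': "j' < length (grid_word c v)" and tv': "?tv j' = grid_time v r' t'"
    using times_grid_word[of c v "grid_time v r' t'"] s'(2) t'(1) game_equivD(3)[OF t'(4)] by blast
  have "s < length u" "t < length v" using game_equivD[OF st] by auto
  note diff = grid_time_diff[OF \<open>s < length u\<close> s'(1)] grid_time_diff[OF s'(1) \<open>s < length u\<close>]
    grid_time_diff[OF \<open>t < length v\<close> t'(1)] grid_time_diff[OF t'(1) \<open>t < length v\<close>]
  note less = grid_time_less_iff[OF \<open>s < length u\<close> s'(1)] grid_time_less_iff[OF s'(1) \<open>s < length u\<close>]
    grid_time_less_iff[OF \<open>t < length v\<close> t'(1)] grid_time_less_iff[OF t'(1) \<open>t < length v\<close>]
  show thesis
  proof (rule that[of j'])
    show "grid_equiv c k u v i' j'"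
      unfolding grid_equiv_def using assms(2) j' t'(4) tu' tv' by blast
    show "i < i' \<longleftrightarrow> j < j'" "i' < i \<longleftrightarrow> j' < j"
      using time_grid_word_less_iff[of _ c u] time_grid_word_less_iff[of _ c v] len assms(2) j'
        tu tv tu' tv' less t'(2,3) by metis+
    show "?tu i' - ?tu i \<in> reals_of I \<longleftrightarrow> ?tv j' - ?tv j \<in> reals_of I"
      "?tu i - ?tu i' \<in> reals_of I \<longleftrightarrow> ?tv j - ?tv j' \<in> reals_of I" for I
      unfolding tu tv tu' tv' by (rule reals_of_cong; simp add: diff t'(2,3))+
  qed (fact j')
qed

lemma mtl_sat_F:
  "mtl_sat \<rho> i (mtl_F I \<phi>) \<longleftrightarrow>
     (\<exists>j. i < j \<and> j < length \<rho> \<and> mtl_sat \<rho> j \<phi> \<and> time_at \<rho> j - time_at \<rho> i \<in> reals_of I)"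
  by (simp add: mtl_F_def)

lemma mtl_sat_P:
  "mtl_sat \<rho> i (mtl_P I \<phi>) \<longleftrightarrow>
     (\<exists>j. j < i \<and> mtl_sat \<rho> j \<phi> \<and> time_at \<rho> i - time_at \<rho> j \<in> reals_of I)"
  by (simp add: mtl_P_def)

text \<open>Each modality costs one round and atoms cost none, as all letters equal
  \<open>c\<close>. For the modalities one implication suffices, by symmetry of
  \<open>grid_equiv\<close>.\<close>

lemma mtl_grid_indistinguishable:
  assumes "\<phi> \<in> MTL_FP"
  shows "\<exists>k. \<forall>u v i j. grid_equiv c k u v i j \<longrightarrow>
    mtl_sat (grid_word c u) i \<phi> = mtl_sat (grid_word c v) j \<phi>"
  using assms
proof induction
  case (1 a)
  then show ?case by (auto simp: grid_equiv_def letter_grid_word)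
next
  case (2 \<phi> \<psi>)
  obtain k where k: "\<And>u v i j. grid_equiv c k u v i j \<Longrightarrow>
      mtl_sat (grid_word c u) i \<phi> = mtl_sat (grid_word c v) j \<phi>"
    using 2(3) by blast
  obtain l where l: "\<And>u v i j. grid_equiv c l u v i j \<Longrightarrow>
      mtl_sat (grid_word c u) i \<psi> = mtl_sat (grid_word c v) j \<psi>"
    using 2(4) by blast
  show ?case
    by (rule exI[of _ "max k l"])
      (metis k l grid_equiv_antimono max.cobounded1 max.cobounded2 mtl_sat.simps(2))
next
  case (3 \<phi>)
  then show ?case by simp
next
  case (4 \<phi> I)
  then obtain k where k: "\<And>u v i j. grid_equiv c k u v i j \<Longrightarrow>
    mtl_sat (grid_word c u) i \<phi> = mtl_sat (grid_word c v) j \<phi>" by blast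
  have "mtl_sat (grid_word c v) j (mtl_F I \<phi>)"
    if eq: "grid_equiv c (Suc k) u v i j" and sat: "mtl_sat (grid_word c u) i (mtl_F I \<phi>)"
    for u v i j
  proof -
    obtain i' where "i < i'" "i' < length (grid_word c u)" "mtl_sat (grid_word c u) i' \<phi>"
      "time_at (grid_word c u) i' - time_at (grid_word c u) i \<in> reals_of I"
      using sat unfolding mtl_sat_F by blast
    then show ?thesis
      using grid_equiv_forth[OF eq, of i'] k unfolding mtl_sat_F by metis
  qed
  then show ?case by (blast intro: grid_equiv_sym)
next
  case (5 \<phi> I)
  then obtain k where k: "\<And>u v i j. grid_equiv c k u v i j \<Longrightarrow>
    mtl_sat (grid_word c u) i \<phi> = mtl_sat (grid_word c v) j \<phi>" by blast
  have "mtl_sat (grid_word c v) j (mtl_P I \<phi>)"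
    if eq: "grid_equiv c (Suc k) u v i j" and sat: "mtl_sat (grid_word c u) i (mtl_P I \<phi>)"
    for u v i j
  proof -
    obtain i' where "i' < i" "mtl_sat (grid_word c u) i' \<phi>"
      "time_at (grid_word c u) i - time_at (grid_word c u) i' \<in> reals_of I"
      using sat unfolding mtl_sat_P by blast
    moreover have "i' < length (grid_word c u)"
      using eq \<open>i' < i\<close> by (simp add: grid_equiv_def)
    ultimately show ?thesis
      using grid_equiv_forth[OF eq, of i'] k unfolding mtl_sat_P by metis
  qed
  then show ?case by (blast intro: grid_equiv_sym)
qed

section \<open>Recovering the untimed word from the event times\<close>

definition one_later :: "'a mtl" where
  "one_later = Until mtl_top (Interval (Closed 1) (Some (Closed 1))) mtl_top"

lemma one_later_BMTL_US: "one_later \<in> BMTL_US"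
  unfolding one_later_def
  by (intro BMTL_US.intros mtl_top_BMTL_US) (simp add: bounded_interval_def)

text \<open>A shift by one unit keeps the column and raises the row. There is no third row, so it
  leads to an event only from first-row positions whose column carries True.\<close>

lemma mtl_sat_one_later:
  assumes "i < length (grid_word c u)"
  shows "mtl_sat (grid_word c u) i one_later \<longleftrightarrow> i < length u \<and> u ! i"
proof -
  let ?t = "time_at (grid_word c u)"
  have "mtl_sat (grid_word c u) i one_later \<longleftrightarrow>
      (\<exists>j. i < j \<and> j < length (grid_word c u) \<and> ?t j - ?t i = 1)"
    by (auto simp: one_later_def reals_of_def)
  also have "\<dots> \<longleftrightarrow> (\<exists>j<length (grid_word c u). ?t j = ?t i + 1)"
    using time_grid_word_less_iff[OF assms] by (smt (verit, best))
  also have "\<dots> \<longleftrightarrow> (\<exists>r s. s < length u \<and> (r = 0 \<or> r = 1 \<and> u ! s) \<and> ?t i + 1 = grid_time u r s)"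
    by (rule times_grid_word)
  also have "\<dots> \<longleftrightarrow> i < length u \<and> u ! i"
  proof
    assume "i < length u \<and> u ! i"
    then show "\<exists>r s. s < length u \<and> (r = 0 \<or> r = 1 \<and> u ! s) \<and> ?t i + 1 = grid_time u r s"
      by (intro exI[of _ 1] exI[of _ i]) (simp add: grid_word_nth grid_time_def)
  next
    assume "\<exists>r s. s < length u \<and> (r = 0 \<or> r = 1 \<and> u ! s) \<and> ?t i + 1 = grid_time u r s"
    then obtain r s where rs: "s < length u" "r = 0 \<or> r = 1 \<and> u ! s" "?t i + 1 = grid_time u r s"
      by blast
    obtain r' s' where s': "s' < length u" "?t i = grid_time u r' s'"
      using assms times_grid_word[of c u "?t i"] by blast
    have eq: "grid_time u (Suc r') s' = grid_time u r s"
      using rs(3) s'(2) by (simp add: grid_time_def)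
    \<comment> \<open>Equal grid times agree in row and column, since neither is less than the
      other.\<close>
    then have "Suc r' = r" "s' = s"
      using grid_time_less_iff[OF s'(1) rs(1), of "Suc r'" r]
        grid_time_less_iff[OF rs(1) s'(1), of r "Suc r'"] by auto
    then have "r' = 0" "u ! s" using rs(2) by auto
    then have "?t i = ?t s"
      using s' \<open>s' = s\<close> by (simp add: grid_word_nth)
    then have "i = s"
      using time_grid_word_less_iff[OF assms, of s] time_grid_word_less_iff[OF _ assms, of s]
        rs(1) length_grid_word[of u c] by (metis less_irrefl linorder_neqE_nat order_less_le_trans)
    then show "i < length u \<and> u ! i" using rs(1) \<open>u ! s\<close> by simp
  qed
  finally show ?thesis .
qed

lemma BMTL_US_not_subsumed_MTL_FP_strict:
  "not_subsumed_over (strict_timed_words :: 'a timed_word set) BMTL_US mtl_lang MTL_FP mtl_lang"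
proof -
  let ?\<phi> = "adjacent_pair one_later :: 'a mtl"
  \<comment> \<open>The choice of letter is free: the grid words carry their information in the
    times alone.\<close>
  define c :: 'a where "c = undefined"
  have "mtl_lang \<psi> \<inter> strict_timed_words \<noteq> mtl_lang ?\<phi> \<inter> strict_timed_words"
    if \<psi>: "\<psi> \<in> MTL_FP" for \<psi> :: "'a mtl"
  proof
    assume eq: "mtl_lang \<psi> \<inter> strict_timed_words = mtl_lang ?\<phi> \<inter> strict_timed_words"
    obtain k where k: "\<And>u v i j. grid_equiv c k u v i j \<Longrightarrow>
        mtl_sat (grid_word c u) i \<psi> = mtl_sat (grid_word c v) j \<psi>"
      using mtl_grid_indistinguishable[OF \<psi>, of c] by blast
    let ?u = "plain_word (Suc k)" and ?v = "stutter_word (Suc k)"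
    have ne: "?u \<noteq> []" "?v \<noteq> []"
      by (simp_all add: plain_word_def stutter_word_def)
    have sat_iff: "mtl_sat (grid_word c w) 0 \<psi> = mtl_sat (grid_word c w) 0 ?\<phi>"
      if "w \<noteq> []" for w
      using eq grid_word_strict[OF that, of c]
      by (auto simp: mtl_lang_def strict_timed_words_def)
    have "0 < length ?u" "0 < length ?v" using ne by auto
    \<comment> \<open>Both words start in row 0, column 0.\<close>
    then have "grid_equiv c k ?u ?v 0 0"
      using game_equiv_plain_stutter[of k] length_grid_word[of ?u c] length_grid_word[of ?v c]
      unfolding grid_equiv_def
      by (intro conjI exI[of _ 0] exI[of _ "0::nat"]) (auto simp: grid_word_nth)
    then have "mtl_sat (grid_word c ?u) 0 ?\<phi> = mtl_sat (grid_word c ?v) 0 ?\<phi>"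
      using sat_iff ne k by blast
    \<comment> \<open>Positions satisfying \<open>one_later\<close> lie in the first row, where
      position and column coincide, so a pair of them would be two adjacent True in
      \<open>plain_word\<close>.\<close>
    moreover have "\<not> mtl_sat (grid_word c ?u) 0 ?\<phi>"
      unfolding mtl_sat_adjacent_pair
      using plain_word_no_adjacent mtl_sat_one_later by (metis Suc_lessD)
    moreover have "mtl_sat (grid_word c ?v) 0 ?\<phi>"
    proof -
      note adj = stutter_word_adjacent[of "Suc k"]
      let ?j = "2 * Suc k"
      have j: "Suc ?j < length ?v" "?v ! ?j" "?v ! Suc ?j" using adj by simp_all
      have t: "grid_word c ?v ! ?j = (c, grid_time ?v 0 ?j)"
        "grid_word c ?v ! Suc ?j = (c, grid_time ?v 0 (Suc ?j))"
        "grid_word c ?v ! 0 = (c, grid_time ?v 0 0)"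
        using j(1) by (auto intro!: grid_word_nth)
      have "grid_time ?v 0 ?j - grid_time ?v 0 0 \<in> {0..<1}"
        "grid_time ?v 0 (Suc ?j) - grid_time ?v 0 ?j \<in> {0..<1}"
        using j(1) by (simp_all add: grid_time_diff_unit del: atLeastLessThan_iff)
      moreover have "Suc ?j < length (grid_word c ?v)"
        using j(1) length_grid_word[of ?v c] by simp
      ultimately show ?thesis
        unfolding mtl_sat_adjacent_pair using j t
        by (intro exI[of _ ?j]) (simp add: mtl_sat_one_later del: mult_Suc_right)
    qed
    ultimately show False by blast
  qed
  then show ?thesis
    unfolding not_subsumed_over_def by (blast intro: adjacent_pair_BMTL_US one_later_BMTL_US)
qed

text \<open>Languages that agree on the larger class also agree on the smaller one.\<close>

lemma not_subsumed_over_mono: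
  assumes "not_subsumed_over C G lang H lang'" "C \<subseteq> D"
  shows "not_subsumed_over D G lang H lang'"
proof -
  obtain \<phi> where \<phi>: "\<phi> \<in> G" "\<And>\<psi>. \<psi> \<in> H \<Longrightarrow> lang' \<psi> \<inter> C \<noteq> lang \<phi> \<inter> C"
    using assms(1) unfolding not_subsumed_over_def by blast
  have "lang' \<psi> \<inter> D \<noteq> lang \<phi> \<inter> D" if "\<psi> \<in> H" for \<psi>
    using \<phi>(2)[OF that] assms(2) by blast
  then show ?thesis
    unfolding not_subsumed_over_def using \<phi>(1) by blast
qed

theorem theorem4:
  fixes X :: "'x set"
  assumes "finite X"
  shows "not_subsumed_over (strict_timed_words :: 'a::finite timed_word set)
           BMTL_US mtl_lang MTL_FP mtl_lang \<and>
         not_subsumed_over (weak_timed_words :: 'a timed_word set)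
           BMTL_US mtl_lang MTL_FP mtl_lang \<and>
         (CARD('a) \<ge> 2 \<longrightarrow>
           not_subsumed_over (weak_timed_words :: 'a timed_word set)
             BMTL_US mtl_lang (TPTL_FP X) tptl_lang)"
proof (intro conjI impI)
  show strict: "not_subsumed_over (strict_timed_words :: 'a timed_word set)
      BMTL_US mtl_lang MTL_FP mtl_lang"
    by (rule BMTL_US_not_subsumed_MTL_FP_strict)
  show "not_subsumed_over (weak_timed_words :: 'a timed_word set)
      BMTL_US mtl_lang MTL_FP mtl_lang"
    using strict by (rule not_subsumed_over_mono) (auto simp: strict_timed_words_def)
  assume "CARD('a) \<ge> 2"
  \<comment> \<open>The two letters encode the Booleans; a set without two distinct elements has
    cardinality at most one.\<close>
  then obtain a b :: 'a where "a \<noteq> b"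
    using card_le_Suc0_iff_eq[of "UNIV :: 'a set"] by fastforce
  then show "not_subsumed_over (weak_timed_words :: 'a timed_word set)
      BMTL_US mtl_lang (TPTL_FP X) tptl_lang"
    by (rule BMTL_US_not_subsumed_TPTL_FP)
qed

end
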